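(* Nielsen's beta function $\beta(z)$ has the asymptotic series, as $z\to\infty$ in $\operatorname{Re}(z)>0$, $$\beta(z)\sim\sum_{n=0}^{\infty}\frac{(-1)^n(1-2^{n+1})B_{n+1}}{n+1}\,\frac{1}{z^{n+1}}=\frac12\sum_{n=0}^{\infty}(-1)^nE_n(0)\,\frac{1}{z^{n+1}},$$ where the equality of the two series is coefficientwise.
   Context: Nielsen's beta function is $\beta(z)=\int_0^1\frac{t^{z-1}}{t+1}\,dt=\sum_{n=0}^{\infty}\frac{(-1)^n}{n+z}$ for $\operatorname{Re}(z)>0$. $B_n$ are the Bernoulli numbers, $\frac{t}{e^t-1}=\sum_{n\ge0}B_n\frac{t^n}{n!}$ (so $B_1=-\frac12$), and $E_n(x)$ are the Euler polynomials, $\frac{2e^{xt}}{e^t+1}=\sum_{n\ge 0}E_n(x)\frac{t^n}{n!}$. The notation $f(z)\sim\sum_{n\ge0}c_nz^{-n-1}$ means that for every integer $N\ge0$, $f(z)-\sum_{n=0}^{N}c_nz^{-n-1}=O(|z|^{-N-2})$ as $|z|\to\infty$. *)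

theory Defs
  imports "HOL-Analysis.Analysis" "HOL-Library.Landau_Symbols"
begin

(* The Henstock-Kurzweil integral agrees with the Lebesgue integral here, since the integrand is
   absolutely integrable for Re z > 0. Only such z are of interest. *)
definition nielsen_beta :: "complex \<Rightarrow> complex" where
  "nielsen_beta z =
     integral {0..1} (\<lambda>t::real. complex_of_real t powr (z - 1) / (complex_of_real t + 1))"

(* The quotients below are quotients of formal power series; the first one is an exact division,
   as the denominator has subdegree 1 (see the generating function lemmas). In particular,
   bernoulli_number 1 = -1/2. *)
definition bernoulli_number :: "nat \<Rightarrow> real" where
  "bernoulli_number n = fact n * fps_nth (fps_X / (fps_exp 1 - 1)) n"

definition euler_polynomial :: "nat \<Rightarrow> real \<Rightarrow> real" where
  "euler_polynomial n x = fact n * fps_nth (2 * fps_exp x / (fps_exp 1 + 1)) n"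

lemma bernoulli_number_gf:
  "Abs_fps (\<lambda>n. bernoulli_number n / fact n) * (fps_exp 1 - 1) = fps_X"
proof -
  have nth1: "fps_nth (fps_exp 1 - 1 :: real fps) 1 = 1" by simp
  then have nz: "fps_exp 1 - 1 \<noteq> (0 :: real fps)" by (metis fps_zero_nth zero_neq_one)
  have "subdegree (fps_exp 1 - 1 :: real fps) = 1"
    by (rule subdegreeI) auto
  then have "fps_exp 1 - 1 dvd (fps_X :: real fps)"
    using nz by (simp add: fps_dvd_iff)
  moreover have "Abs_fps (\<lambda>n. bernoulli_number n / fact n) = fps_X / (fps_exp 1 - 1)"
    by (simp add: fps_eq_iff bernoulli_number_def)
  ultimately show ?thesis by simp
qed

lemma euler_polynomial_gf:
  "Abs_fps (\<lambda>n. euler_polynomial n x / fact n) * (fps_exp 1 + 1) = 2 * fps_exp x"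
proof -
  have "fps_nth (fps_exp 1 + 1 :: real fps) 0 \<noteq> 0" by simp
  then have "is_unit (fps_exp 1 + 1 :: real fps)" by (simp only: fps_is_unit_iff not_False_eq_True)
  then have "fps_exp 1 + 1 dvd 2 * fps_exp x" by (rule unit_imp_dvd)
  moreover have "Abs_fps (\<lambda>n. euler_polynomial n x / fact n) = 2 * fps_exp x / (fps_exp 1 + 1)"
    by (simp add: fps_eq_iff euler_polynomial_def)
  ultimately show ?thesis by simp
qed

(* f(z) ~ c(0)/z + c(1)/z^2 + c(2)/z^3 + ... along the filter F *)
definition has_asymptotic_series ::
    "complex filter \<Rightarrow> (complex \<Rightarrow> complex) \<Rightarrow> (nat \<Rightarrow> complex) \<Rightarrow> bool" where
  "has_asymptotic_series F f c \<longleftrightarrow>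
     (\<forall>N. (\<lambda>z. f z - (\<Sum>n\<le>N. c n / z ^ (n + 1))) \<in> O[F](\<lambda>z. 1 / z ^ (N + 2)))"

definition at_infinity_right_half_plane :: "complex filter" where
  "at_infinity_right_half_plane = inf at_infinity (principal {z. Re z > 0})"

end

theory Submission
  imports Defs
begin

text \<open>
  Write \<open>\<theta>\<close> for the Euler operator \<open>t d/dt\<close>, and let \<open>u(t) = 1/(1 + t)\<close>. Integrating
  \<open>\<theta>(t\<^sup>z g(t))\<close> against \<open>dt/t\<close> over \<open>[0, 1]\<close> gives, for smooth \<open>g\<close> and \<open>Re z > 0\<close>,
  \<open>\<integral> t\<^bsup>z-1\<^esup> g dt = g(1)/z - (1/z) \<integral> t\<^bsup>z-1\<^esup> \<theta>g dt\<close>. Starting from \<open>g = u\<close>, whose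
  integral is \<open>\<beta>(z)\<close>, and repeating, one obtains an expansion in powers of \<open>1/z\<close> directly, with
  coefficients \<open>(-1)\<^sup>n (\<theta>\<^sup>n u)(1)\<close>. The factor \<open>t\<close> in \<open>\<theta>g = t g'\<close> cancels the singularity
  of \<open>t\<^bsup>z-1\<^esup>\<close> at 0, so that the integrand of the remainder is bounded by a constant times
  \<open>\<bar>t\<^sup>z\<bar> \<le> 1\<close>. This makes the estimate uniform on the whole open right half plane, up to the
  imaginary axis, rather than only in sectors.

  Since \<open>\<theta>u = u\<^sup>2 - u\<close>, every \<open>\<theta>\<^sup>n u\<close> is a polynomial \<open>P\<^sub>n\<close> in \<open>u\<close>, and
  \<open>(\<theta>\<^sup>n u)(1) = P\<^sub>n(1/2)\<close>. Substituting \<open>t = e\<^sup>x\<close> turns \<open>\<theta>\<close> into \<open>d/dx\<close> and \<open>u\<close> into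
  \<open>1/(1 + e\<^sup>x)\<close>, which is half of the generating function of the \<open>E\<^sub>n(0)\<close>; hence
  \<open>P\<^sub>n(1/2) = E\<^sub>n(0)/2\<close> (\<open>poly_logistic_poly_half\<close>). This part is carried out with formal power
  series. The analytic part rests on \<open>mellin_by_parts\<close> and \<open>mellin_bounded\<close>. The Bernoulli form of
  the coefficients comes from the partial fraction identity
  \<open>1/(e\<^sup>x + 1) = 1/(e\<^sup>x - 1) - 2/(e\<^bsup>2x\<^esup> - 1)\<close>.
\<close>

text \<open>
  These are the polynomials \<open>P\<^sub>n\<close> with \<open>\<theta>\<^sup>n u = P\<^sub>n(u)\<close>. As \<open>\<theta>u = u\<^sup>2 - u\<close>, applying
  \<open>\<theta>\<close> to \<open>p(u)\<close> gives \<open>p'(u) (u\<^sup>2 - u)\<close>, so the factor \<open>[:0, -1, 1:]\<close> below always stands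
  for one application of \<open>\<theta>\<close>.
\<close>

primrec logistic_poly :: "nat \<Rightarrow> real poly" where
  "logistic_poly 0 = [:0, 1:]"
| "logistic_poly (Suc n) = pderiv (logistic_poly n) * [:0, -1, 1:]"

abbreviation const_poly :: "real poly \<Rightarrow> real fps poly" where
  "const_poly \<equiv> map_poly fps_const"

lemma fps_deriv_poly_const:
  "fps_deriv (poly (const_poly p) U) = poly (const_poly (pderiv p)) U * fps_deriv U"
proof -
  have chain: "fps_deriv (poly (const_poly p) U) = poly (pderiv (const_poly p)) U * fps_deriv U"
    by (induction p) (simp_all add: map_poly_pCons pderiv_pCons algebra_simps)
  have "pderiv (const_poly p) = const_poly (pderiv p)"
    by (rule poly_eqI) (simp add: coeff_pderiv coeff_map_poly fps_of_nat del: of_nat_Suc flip: fps_const_mult)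
  with chain show ?thesis by simp
qed

text \<open>
  The logistic equation \<open>U' = U\<^sup>2 - U\<close> is all that the recursion for the \<open>P\<^sub>n\<close> encodes.
\<close>

lemma logistic_poly_fps_deriv:
  fixes U :: "real fps"
  assumes "fps_deriv U = U ^ 2 - U"
  shows "(fps_deriv ^^ n) U = poly (const_poly (logistic_poly n)) U"
proof (induction n)
  case 0
  show ?case by (simp add: map_poly_pCons)
next
  case (Suc n)
  have "const_poly (q * [:0, -1, 1:]) = const_poly q * [:0, -1, 1:]" for q :: "real poly"
    by (rule poly_eqI) (simp add: coeff_map_poly coeff_pCons split: nat.splits)
  then show ?case
    by (simp add: Suc fps_deriv_poly_const assms power2_eq_square algebra_simps)
qed

lemma fps_nth_0_poly_const: "fps_nth (poly (const_poly p) U) 0 = poly p (fps_nth U 0)"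
  by (induction p) (simp_all add: map_poly_pCons)

text \<open>
  Both sides are the value at 0 of the \<open>n\<close>-th derivative of \<open>1/(e\<^sup>x + 1)\<close>: the left one because
  this series solves the logistic equation with constant term \<open>1/2\<close>, the right one because the
  generating function of the \<open>E\<^sub>n(0)\<close> is \<open>2/(e\<^sup>x + 1)\<close>.
\<close>

lemma poly_logistic_poly_half:
  "poly (logistic_poly n) (1 / 2) = euler_polynomial n 0 / 2"
proof -
  define U :: "real fps" where "U = inverse (fps_exp 1 + 1)"
  have inv: "(fps_exp 1 + 1) * U = 1"
    unfolding U_def by (rule inverse_mult_eq_1') simp
  have "fps_deriv U = - fps_exp 1 * U ^ 2"
    unfolding U_def by (subst fps_inverse_deriv) simp_all
  also have "\<dots> = U ^ 2 - ((fps_exp 1 + 1) * U) * U"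
    by (simp add: power2_eq_square algebra_simps)
  finally have deriv: "fps_deriv U = U ^ 2 - U"
    by (simp add: inv)
  have "Abs_fps (\<lambda>n. euler_polynomial n 0 / fact n) * ((fps_exp 1 + 1) * U) = 2 * U"
    using euler_polynomial_gf[of 0] by (simp flip: mult.assoc)
  then have "fps_nth (Abs_fps (\<lambda>n. euler_polynomial n 0 / fact n)) n = fps_nth (2 * U) n"
    by (simp only: inv mult_1_right)
  then have "euler_polynomial n 0 = 2 * (fact n * fps_nth U n)"
    by (simp add: numeral_fps_const field_simps)
  also have "fact n * fps_nth U n = fps_nth ((fps_deriv ^^ n) U) 0"
    by (simp add: fps_0th_higher_deriv)
  also have "\<dots> = poly (logistic_poly n) (fps_nth U 0)"
    by (simp only: logistic_poly_fps_deriv[OF deriv] fps_nth_0_poly_const)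
  finally show ?thesis by (simp add: U_def)
qed

text \<open>
  Let \<open>B(x)\<close> and \<open>E(x)\<close> be the generating functions of the \<open>B\<^sub>n\<close> and of the \<open>E\<^sub>n(0)\<close>. The
  partial fraction identity above reads \<open>x E(x) = 2 (B(x) - B(2x))\<close>, and the claim compares
  coefficients of \<open>x\<^bsup>n+1\<^esup>\<close>. To avoid dividing power series, the identity is checked after
  multiplication by \<open>e\<^bsup>2x\<^esup> - 1 = (e\<^sup>x - 1)(e\<^sup>x + 1)\<close>.
\<close>

lemma bernoulli_eq_euler_polynomial_0:
  "(1 - 2 ^ (n + 1)) * bernoulli_number (n + 1) / real (n + 1) = euler_polynomial n 0 / 2"
proof -
  define B where "B = Abs_fps (\<lambda>n. bernoulli_number n / fact n)"
  define B2 where "B2 = fps_compose B (fps_const 2 * fps_X)"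
  define E where "E = Abs_fps (\<lambda>n. euler_polynomial n 0 / fact n)"
  define e :: "real fps" where "e = fps_exp 1"
  have B: "B * (e - 1) = fps_X" and E: "E * (e + 1) = 2"
    using bernoulli_number_gf euler_polynomial_gf[of 0] by (simp_all add: B_def E_def e_def)
  have e2: "fps_compose e (fps_const 2 * fps_X) = e * e"
    unfolding e_def by (simp flip: fps_exp_add_mult)
  have "fps_compose (B * (e - 1)) (fps_const 2 * fps_X) = B2 * (e * e - 1)"
    by (simp add: fps_compose_mult_distrib fps_compose_sub_distrib e2 B2_def)
  then have B2: "B2 * (e * e - 1) = 2 * fps_X"
    by (simp add: B numeral_fps_const)
  have "(fps_X * E) * (e * e - 1) = fps_X * (E * (e + 1)) * (e - 1)"
    by (simp add: algebra_simps)
  also have "\<dots> = 2 * (fps_X * (e + 1) - 2 * fps_X)"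
    unfolding E by (simp add: algebra_simps)
  also have "\<dots> = 2 * ((B * (e - 1)) * (e + 1) - B2 * (e * e - 1))"
    by (simp only: B B2)
  also have "\<dots> = (2 * (B - B2)) * (e * e - 1)"
    by (simp add: algebra_simps)
  finally have eq: "(fps_X * E) * (e * e - 1) = (2 * (B - B2)) * (e * e - 1)" .
  have "e * e - 1 \<noteq> 0"
    using B2 by force
  with eq have "fps_X * E = 2 * (B - B2)"
    by simp
  then have "fps_nth (fps_X * E) (Suc n) = fps_nth (2 * (B - B2)) (Suc n)"
    by simp
  moreover have "fps_nth B2 k = 2 ^ k * fps_nth B k" for k
    by (simp add: B2_def fps_compose_linear)
  ultimately have "euler_polynomial n 0 / fact n =
      2 * ((1 - 2 ^ Suc n) * bernoulli_number (Suc n) / fact (Suc n))"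
    by (simp add: numeral_fps_const B_def E_def algebra_simps diff_divide_distrib)
  also have "\<dots> = 2 * ((1 - 2 ^ (n + 1)) * bernoulli_number (n + 1) / real (n + 1)) / fact n"
    by (simp only: fact_Suc) (simp del: of_nat_Suc)
  finally have "euler_polynomial n 0 =
      2 * ((1 - 2 ^ (n + 1)) * bernoulli_number (n + 1) / real (n + 1))"
    by (simp only: divide_cancel_right fact_nonzero simp_thms)
  then show ?thesis
    by linarith
qed

text \<open>
  Indexing the truncated Mellin transform of \<open>p(u)\<close> by the polynomial \<open>p\<close>, instead of by a
  function, makes the integration by parts a recursion on polynomials.
\<close>

definition mellin :: "real poly \<Rightarrow> complex \<Rightarrow> complex" where
  "mellin p z = integral {0..1}
     (\<lambda>t. complex_of_real t powr (z - 1) * complex_of_real (poly p (1 / (1 + t))))"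

lemma nielsen_beta_eq_mellin: "nielsen_beta z = mellin (logistic_poly 0) z"
  by (simp add: nielsen_beta_def mellin_def add.commute)

text \<open>
  Since \<open>u\<^sup>2 - u = -t u\<^sup>2\<close>, the factor coming from \<open>\<theta>\<close> absorbs the singularity of
  \<open>t\<^bsup>z-1\<^esup>\<close>. At \<open>t = 0\<close> both sides vanish because \<open>0 powr w = 0\<close>.
\<close>

lemma logistic_integrand:
  assumes "t \<in> {0..1}"
  shows "complex_of_real t powr (z - 1) * complex_of_real (poly (p * [:0, -1, 1:]) (1 / (1 + t)))
    = complex_of_real t powr z * complex_of_real (- poly p (1 / (1 + t)) / (1 + t) ^ 2)"
proof (cases "t = 0")
  case False
  have "1 + t \<noteq> 0" using assms by auto
  then have "poly (p * [:0, -1, 1:]) (1 / (1 + t)) = t * (- poly p (1 / (1 + t)) / (1 + t) ^ 2)"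
    by (simp add: field_simps power2_eq_square)
  then show ?thesis
    using False by (simp add: powr_diff del: poly_mult)
qed simp

lemma continuous_on_of_real_powr_mult:
  assumes "Re z > 0" "continuous_on {0..1} g"
  shows "continuous_on {0..1} (\<lambda>t. complex_of_real t powr z * complex_of_real (g t))"
  by (intro continuous_intros continuous_on_powr_complex) (use assms in auto)

lemma mellin_integrand_continuous:
  assumes "Re z > 0"
  shows "continuous_on {0..1} (\<lambda>t. complex_of_real t powr (z - 1) *
    complex_of_real (poly (p * [:0, -1, 1:]) (1 / (1 + t))))"
proof -
  have "continuous_on {0..1} (\<lambda>t::real. - poly p (1 / (1 + t)) / (1 + t) ^ 2)"
    by (intro continuous_intros) (auto simp: add_nonneg_eq_0_iff)
  from continuous_on_of_real_powr_mult[OF assms this] show ?thesis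
    by (rule continuous_on_cong[THEN iffD1, rotated -1]) (simp_all only: logistic_integrand)
qed

text \<open>
  The boundary term at 0 vanishes because \<open>Re z > 0\<close>. For \<open>Re z < 1\<close> the integrand of
  \<open>mellin p z\<close> may be unbounded near 0. Its integrability is therefore deduced: the antiderivative
  \<open>t\<^sup>z p(u)\<close> is continuous on \<open>[0, 1]\<close>, so its derivative on \<open>(0, 1)\<close> is integrable, and
  the other term of that derivative is continuous.
\<close>

lemma mellin_by_parts:
  assumes "Re z > 0"
  shows "mellin p z = complex_of_real (poly p (1 / 2)) / z - mellin (pderiv p * [:0, -1, 1:]) z / z"
proof -
  have z: "z \<noteq> 0" using assms by auto
  define q where "q = pderiv p * [:0, -1, 1:]"
  define h where "h r t = complex_of_real t powr (z - 1) * complex_of_real (poly r (1 / (1 + t)))"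
    for r and t :: real
  define F where "F t = complex_of_real t powr z * complex_of_real (poly p (1 / (1 + t)))" for t :: real
  have "((\<lambda>t. z * h p t + h q t) has_integral (F 1 - F 0)) {0..1}"
  proof (rule fundamental_theorem_of_calculus_interior)
    show "continuous_on {0..1} F" unfolding F_def
      by (intro continuous_on_of_real_powr_mult assms continuous_intros) (auto simp: add_nonneg_eq_0_iff)
  next
    fix t :: real assume t: "t \<in> {0<..<1}"
    define d where "d = - poly (pderiv p) (1 / (1 + t)) / (1 + t) ^ 2"
    have "((\<lambda>t. poly p (1 / (1 + t))) has_real_derivative d) (at t)"
      using t unfolding d_def
      by (auto intro!: derivative_eq_intros DERIV_chain2[OF poly_DERIV] simp: field_simps power2_eq_square)
    then have d: "((\<lambda>t. complex_of_real (poly p (1 / (1 + t)))) has_vector_derivative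
        complex_of_real d) (at t)"
      by (intro has_vector_derivative_of_real)
         (simp add: has_real_derivative_iff_has_vector_derivative)
    have "((\<lambda>w. w powr z) has_field_derivative (z * complex_of_real t powr (z - 1))) 
        (at (complex_of_real t))"
      using t by (intro has_field_derivative_powr) (auto simp: complex_nonpos_Reals_iff)
    then have "((\<lambda>t. complex_of_real t powr z) has_vector_derivative
        z * complex_of_real t powr (z - 1)) (at t)"
      by (rule has_vector_derivative_real_field)
    from has_vector_derivative_mult[OF this d]
    have "(F has_vector_derivative complex_of_real t powr z * complex_of_real d + z * h p t) (at t)"
      unfolding F_def h_def by (simp add: mult.assoc)
    also have "complex_of_real t powr z * complex_of_real d = h q t"
      using t unfolding d_def h_def q_def by (subst logistic_integrand) simp_all
    finally show "(F has_vector_derivative z * h p t + h q t) (at t)"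
      by (simp add: add.commute)
  qed simp
  then have sum: "((\<lambda>t. z * h p t + h q t) has_integral complex_of_real (poly p (1 / 2))) {0..1}"
    by (simp add: F_def)
  have "h q integrable_on {0..1}"
    unfolding h_def q_def
    by (intro integrable_continuous_interval mellin_integrand_continuous assms)
  then have q: "(h q has_integral mellin q z) {0..1}"
    unfolding mellin_def h_def by (rule integrable_integral)
  have "(h p has_integral (complex_of_real (poly p (1 / 2)) - mellin q z) / z) {0..1}"
    using has_integral_divide[OF has_integral_diff[OF sum q], of z] z by simp
  then have "mellin p z = (complex_of_real (poly p (1 / 2)) - mellin q z) / z"
    unfolding mellin_def h_def by (rule integral_unique)
  then show ?thesis by (simp add: q_def diff_divide_distrib)
qed

text \<open>
  The constant does not depend on \<open>z\<close>: the integrand is \<open>t\<^sup>z\<close> times a function that is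
  continuous on \<open>[0, 1]\<close> and does not involve \<open>z\<close>, and \<open>\<bar>t\<^sup>z\<bar> \<le> 1\<close>.
\<close>

lemma mellin_bounded:
  obtains C where "\<And>z. Re z > 0 \<Longrightarrow> norm (mellin (p * [:0, -1, 1:]) z) \<le> C"
proof -
  define g where "g t = - poly p (1 / (1 + t)) / (1 + t) ^ 2" for t :: real
  have "continuous_on {0..1} g"
    unfolding g_def by (intro continuous_intros) (auto simp: add_nonneg_eq_0_iff)
  then have "compact (g ` {0..1})"
    by (intro compact_continuous_image) auto
  then obtain C where C: "\<forall>t\<in>{0..1}. \<bar>g t\<bar> \<le> C"
    by (fastforce dest!: compact_imp_bounded simp: bounded_iff)
  have "norm (mellin (p * [:0, -1, 1:]) z) \<le> C" if z: "Re z > 0" for z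
  proof -
    have "norm (mellin (p * [:0, -1, 1:]) z) \<le> C * (1 - 0)"
      unfolding mellin_def
    proof (rule integral_bound)
      fix t :: real assume t: "t \<in> {0..1}"
      have "norm (complex_of_real t powr z) = t powr Re z"
        using t by (simp add: norm_powr_real_powr)
      also have "\<dots> \<le> 1"
        using t z by (intro powr_le1) auto
      finally have "norm (complex_of_real t powr z) * \<bar>g t\<bar> \<le> 1 * C"
        using C t by (intro mult_mono) auto
      then show "norm (complex_of_real t powr (z - 1) *
          complex_of_real (poly (p * [:0, -1, 1:]) (1 / (1 + t)))) \<le> C"
        unfolding logistic_integrand[OF t] norm_mult norm_of_real g_def by simp
    qed (rule mellin_integrand_continuous[OF z] | simp)+
    then show ?thesis by simp
  qed
  then show ?thesis by (rule that)
qed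

lemma nielsen_beta_expansion:
  assumes "Re z > 0"
  shows "nielsen_beta z = (\<Sum>n<N. (-1) ^ n * complex_of_real (poly (logistic_poly n) (1 / 2)) / z ^ (n + 1))
    + (-1) ^ N * mellin (logistic_poly N) z / z ^ N"
proof (induction N)
  case 0
  show ?case by (simp add: nielsen_beta_eq_mellin)
next
  case (Suc N)
  have "z \<noteq> 0" using assms by auto
  then show ?case
    unfolding Suc by (subst mellin_by_parts[OF assms]) (simp add: field_simps)
qed

theorem proposition7:
  shows "has_asymptotic_series at_infinity_right_half_plane nielsen_beta
           (\<lambda>n. complex_of_real
                  ((-1) ^ n * (1 - 2 ^ (n + 1)) * bernoulli_number (n + 1) / real (n + 1)))
       \<and> (\<forall>n::nat. (-1) ^ n * (1 - 2 ^ (n + 1)) * bernoulli_number (n + 1) / real (n + 1)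
                   = 1 / 2 * ((-1) ^ n * euler_polynomial n 0))"
proof
  define c :: "nat \<Rightarrow> real" where
    "c n = (-1) ^ n * (1 - 2 ^ (n + 1)) * bernoulli_number (n + 1) / real (n + 1)" for n
  have euler: "c n = (-1) ^ n * (euler_polynomial n 0 / 2)" for n
    unfolding bernoulli_eq_euler_polynomial_0[symmetric] c_def by simp
  show "\<forall>n::nat. (-1) ^ n * (1 - 2 ^ (n + 1)) * bernoulli_number (n + 1) / real (n + 1)
                   = 1 / 2 * ((-1) ^ n * euler_polynomial n 0)"
    using euler unfolding c_def by simp
  have c: "complex_of_real (c n) = (-1) ^ n * complex_of_real (poly (logistic_poly n) (1 / 2))" for n
    by (simp add: euler poly_logistic_poly_half)
  show "has_asymptotic_series at_infinity_right_half_plane nielsen_beta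
           (\<lambda>n. complex_of_real
                  ((-1) ^ n * (1 - 2 ^ (n + 1)) * bernoulli_number (n + 1) / real (n + 1)))"
    unfolding has_asymptotic_series_def c_def[symmetric]
  proof
    fix N
    \<comment> \<open>Expanding to \<open>N + 2\<close> terms, one more than the partial sum has, makes the remainder
      \<open>O(z\<^bsup>-N-2\<^esup>)\<close>; the additional term is itself of that order.\<close>
    obtain C where C: "\<And>z. Re z > 0 \<Longrightarrow> norm (mellin (logistic_poly (Suc (N + 1))) z) \<le> C"
      using mellin_bounded[of "pderiv (logistic_poly (N + 1))"] by auto
    have "norm (nielsen_beta z - (\<Sum>n\<le>N. complex_of_real (c n) / z ^ (n + 1)))
        \<le> (\<bar>c (N + 1)\<bar> + C) * norm (1 / z ^ (N + 2))" if z: "Re z > 0" for z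
    proof -
      have "nielsen_beta z - (\<Sum>n\<le>N. complex_of_real (c n) / z ^ (n + 1))
          = (complex_of_real (c (N + 1)) + (-1) ^ N * mellin (logistic_poly (Suc (N + 1))) z)
            * (1 / z ^ (N + 2))"
        unfolding nielsen_beta_expansion[OF z, of "N + 2"] c
        by (simp add: lessThan_Suc_atMost add_divide_distrib distrib_right)
      moreover have "norm (complex_of_real (c (N + 1)) + (-1) ^ N * mellin (logistic_poly (Suc (N + 1))) z)
          \<le> \<bar>c (N + 1)\<bar> + C"
        using C[OF z] by (intro norm_triangle_le) (simp add: norm_mult norm_power)
      ultimately show ?thesis
        by (simp only: norm_mult mult_right_mono norm_ge_zero)
    qed
    then show "(\<lambda>z. nielsen_beta z - (\<Sum>n\<le>N. complex_of_real (c n) / z ^ (n + 1)))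
        \<in> O[at_infinity_right_half_plane](\<lambda>z. 1 / z ^ (N + 2))"
      by (intro bigoI[where c = "\<bar>c (N + 1)\<bar> + C"])
         (simp add: at_infinity_right_half_plane_def eventually_inf_principal)
  qed
qed

end
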